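(* There do not exist eigensimple graphs on $n \geq 32$ vertices.
   Context: Graphs are finite, simple and unweighted; $\overline{G}$ denotes the complement of $G$. The Laplacian matrix $L(G)$ is indexed by $V(G)$, with $[L(G)]_{v,v}=d_G(v)$ (the degree of $v$), $[L(G)]_{v,w}=-1$ if $\{v,w\}\in E(G)$, and $0$ otherwise. Its eigenvalues are listed with multiplicity as $0=\lambda_1(G)\leq\lambda_2(G)\leq\cdots\leq\lambda_n(G)$. A simple graph $G$ on $n\geq 3$ vertices is called eigensimple if $\lambda_2(G)=\lambda_2(\overline{G})=1$, $\lambda_3(G)\geq 2$ and $\lambda_3(\overline{G})\geq 2$. *)

theory Defs
  imports "HOL-Analysis.Analysis" "HOL-Computational_Algebra.Polynomial"
begin

text \<open>
  A graph is given by its set \<open>E\<close> of edges, each edge being a two-element set of vertices. The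
  vertex set is the whole (finite, nonempty) type of vertices, so the number of vertices is the
  cardinality of that type.
\<close>

definition simple_graph :: "'v::finite set set \<Rightarrow> bool" where
  "simple_graph E \<longleftrightarrow> (\<forall>e\<in>E. card e = 2)"

definition graph_complement :: "'v::finite set set \<Rightarrow> 'v set set" where
  "graph_complement E = {e. card e = 2 \<and> e \<notin> E}"

definition vertex_degree :: "'v::finite set set \<Rightarrow> 'v \<Rightarrow> nat" where
  "vertex_degree E v = card {e \<in> E. v \<in> e}"

definition laplacian :: "'v::finite set set \<Rightarrow> real^'v^'v" where
  "laplacian E = (\<chi> v w. if v = w then real (vertex_degree E v)
                          else if {v, w} \<in> E then - 1 else 0)"

text \<open>The determinant of \<open>X I - A\<close>, taken over the ring of real polynomials.\<close>

definition charpoly :: "real^'n^'n \<Rightarrow> real poly" where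
  "charpoly A = det (mat [:0, 1:] - (\<chi> i j. [:A $ i $ j:]))"

text \<open>
  The real roots of the characteristic polynomial, with algebraic multiplicity, in weakly
  increasing order. For a symmetric matrix (such as a Laplacian) the list has as many entries as
  the matrix has rows.
\<close>

definition eigenvalue_list :: "real^'n^'n \<Rightarrow> real list" where
  "eigenvalue_list A = sorted_list_of_multiset (proots (charpoly A))"

text \<open>
  The \<open>k\<close>-th smallest Laplacian eigenvalue. The index \<open>k\<close> starts at 1, and is meaningful for
  \<open>k\<close> between 1 and the number of vertices.
\<close>

definition laplacian_eigenvalue :: "nat \<Rightarrow> 'v::finite set set \<Rightarrow> real" where
  "laplacian_eigenvalue k E = eigenvalue_list (laplacian E) ! (k - 1)"

definition eigensimple :: "'v::finite set set \<Rightarrow> bool" where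
  "eigensimple E \<longleftrightarrow>
     simple_graph E \<and> CARD('v) \<ge> 3 \<and>
     laplacian_eigenvalue 2 E = 1 \<and> laplacian_eigenvalue 2 (graph_complement E) = 1 \<and>
     laplacian_eigenvalue 3 E \<ge> 2 \<and> laplacian_eigenvalue 3 (graph_complement E) \<ge> 2"

end

theory Submission
  imports Defs
begin

text \<open>
  Let \<open>x\<close> and \<open>y\<close> be eigenvectors for the eigenvalue 1 of the two Laplacians, both orthogonal to the
  constants and of \<open>l\<^sup>1\<close>-norm 2. At a vertex of degree \<open>d\<close> we have \<open>d \<bar>x\<bar> \<le> 1\<close>, and \<open>(n - 1 - d) \<bar>y\<bar> \<le> 1\<close>,
  so for large \<open>n\<close> no vertex carries large values of both. Call opposition at \<open>v\<close> the mass of \<open>x\<close> with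
  the sign opposite to \<open>x v\<close> on the neighbours of \<open>v\<close>; the total opposition is exactly 1, for \<open>x\<close> and
  for \<open>y\<close>. Double counting the product of the positive masses of \<open>x\<close> and \<open>y\<close> shows
  \<open>max \<bar>x\<bar> + max \<bar>y\<bar> > 1/2\<close>, and then both maxima are at least \<open>2/13\<close>. Passing to the complement if
  necessary, the peak \<open>a\<close> of \<open>x\<close> is adjacent to the peak \<open>c\<close> of \<open>y\<close>. Since \<open>x c\<close> is small and no
  vertex is a cut vertex (the equality case of the spectral gap), \<open>x\<close> is almost as large as
  \<open>x a\<close> at two further vertices and at all neighbours of these three. There \<open>y\<close> is small, so each of
  the three vertices has \<open>y\<close>-opposition at least \<open>4/11\<close>, which exceeds the total 1.
\<close>

section \<open>Eigenvectors as functions on the vertices\<close>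

definition nb :: "('v \<Rightarrow> 'v \<Rightarrow> bool) \<Rightarrow> 'v \<Rightarrow> 'v::finite set" where
  "nb A v = {w. A v w}"

definition deg :: "('v \<Rightarrow> 'v \<Rightarrow> bool) \<Rightarrow> 'v::finite \<Rightarrow> nat" where
  "deg A v = card (nb A v)"

definition co :: "('v \<Rightarrow> 'v \<Rightarrow> bool) \<Rightarrow> 'v \<Rightarrow> 'v \<Rightarrow> bool" where
  "co A v w \<longleftrightarrow> v \<noteq> w \<and> \<not> A v w"

definition pos :: "real \<Rightarrow> real" where "pos t = max t 0"

text \<open>For an eigenvector this is the mass of the sign opposite to \<open>x v\<close>, see \<open>opp_cases\<close>.\<close>
definition opp :: "('v::finite \<Rightarrow> 'v \<Rightarrow> bool) \<Rightarrow> ('v \<Rightarrow> real) \<Rightarrow> 'v \<Rightarrow> real" where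
  "opp A x v = min (\<Sum>w\<in>nb A v. pos (x w)) (\<Sum>w\<in>nb A v. pos (- x w))"

text \<open>The eigenvalue equation for eigenvalue 1, with the Laplacian written out.\<close>
definition eigf :: "('v::finite \<Rightarrow> 'v \<Rightarrow> bool) \<Rightarrow> ('v \<Rightarrow> real) \<Rightarrow> bool" where
  "eigf A x \<longleftrightarrow> (\<forall>v. (\<Sum>w\<in>nb A v. x w) = (real (deg A v) - 1) * x v)
     \<and> (\<Sum>v\<in>UNIV. x v) = 0 \<and> (\<Sum>v\<in>UNIV. \<bar>x v\<bar>) = 2"

locale adjacency =
  fixes A :: "'v::finite \<Rightarrow> 'v \<Rightarrow> bool"
  assumes adj_sym: "A v w \<Longrightarrow> A w v" and adj_irrefl: "\<not> A v v"

text \<open>\<open>tough\<close> says that deleting any single vertex \<open>c\<close> leaves a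
  connected graph; \<open>D\<close> and the remaining vertices are the two sides of a possible
  disconnection.\<close>

locale tough_graph = adjacency A for A :: "'v::finite \<Rightarrow> 'v \<Rightarrow> bool" +
  assumes tough: "\<lbrakk>c \<notin> D; D \<noteq> {}; insert c D \<noteq> UNIV\<rbrakk> \<Longrightarrow> \<exists>s\<in>D. \<exists>t. t \<notin> insert c D \<and> A s t"
    and many: "CARD('v) \<ge> 32"

section \<open>Positive and negative parts of an eigenfunction\<close>

lemma pos_diff: "pos t - pos (- t) = t" by (auto simp: pos_def)
lemma pos_sum: "pos t + pos (- t) = \<bar>t\<bar>" by (auto simp: pos_def)
lemma pos_nonneg [simp]: "0 \<le> pos t" by (auto simp: pos_def)
lemma pos_le_abs: "pos t \<le> \<bar>t\<bar>" by (auto simp: pos_def)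
lemma pos_eq [simp]: "0 \<le> t \<Longrightarrow> pos t = t" "t \<le> 0 \<Longrightarrow> pos t = 0" by (auto simp: pos_def)

lemma eigf_pos:
  assumes "eigf A x" shows "(\<Sum>v\<in>UNIV. pos (x v)) = 1" "(\<Sum>v\<in>UNIV. pos (- x v)) = 1"
proof -
  have "(\<Sum>v\<in>UNIV. pos (x v)) - (\<Sum>v\<in>UNIV. pos (- x v)) = 0"
    using assms by (simp add: eigf_def pos_diff flip: sum_subtractf)
  moreover have "(\<Sum>v\<in>UNIV. pos (x v)) + (\<Sum>v\<in>UNIV. pos (- x v)) = 2"
    using assms by (simp add: eigf_def pos_sum flip: sum.distrib)
  ultimately show "(\<Sum>v\<in>UNIV. pos (x v)) = 1" "(\<Sum>v\<in>UNIV. pos (- x v)) = 1" by linarith+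
qed

lemma eigf_uminus: "eigf A x \<Longrightarrow> eigf A (\<lambda>v. - x v)"
  by (auto simp: eigf_def sum_negf)

lemma opp_uminus: "opp A (\<lambda>v. - x v) v = opp A x v"
  by (simp add: opp_def min.commute)

lemma eigf_subset_le:
  assumes "eigf A x" shows "\<bar>\<Sum>v\<in>S. x v\<bar> \<le> 1"
proof -
  have "(\<Sum>v\<in>S. x v) \<le> (\<Sum>v\<in>S. pos (x v))" by (rule sum_mono) (simp add: pos_def)
  also have "\<dots> \<le> (\<Sum>v\<in>UNIV. pos (x v))" by (rule sum_mono2) auto
  finally have 1: "(\<Sum>v\<in>S. x v) \<le> 1" using eigf_pos[OF assms] by simp
  have "- (\<Sum>v\<in>S. x v) \<le> (\<Sum>v\<in>S. pos (- x v))" 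
    unfolding sum_negf[symmetric] by (rule sum_mono) (simp add: pos_def)
  also have "\<dots> \<le> (\<Sum>v\<in>UNIV. pos (- x v))" by (rule sum_mono2) auto
  finally have "- (\<Sum>v\<in>S. x v) \<le> 1" using eigf_pos[OF assms] by simp
  with 1 show ?thesis by linarith
qed

lemma opp_nonneg [simp]: "0 \<le> opp A x v"
  by (simp add: opp_def sum_nonneg)

lemma finite_peak:
  fixes f :: "'a \<Rightarrow> real"
  assumes "finite S" "S \<noteq> {}"
  obtains s where "s \<in> S" "\<And>t. t \<in> S \<Longrightarrow> f t \<le> f s"
proof -
  have "Max (f ` S) \<in> f ` S" using assms by (intro Max_in) auto
  then obtain s where "s \<in> S" "f s = Max (f ` S)" by auto
  with assms show ?thesis by (intro that[of s]) auto
qed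

lemma positive_peak:
  assumes "eigf A x"
  obtains x' a where "eigf A x'" "\<And>w. \<bar>x' w\<bar> \<le> x' a"
proof -
  obtain a where a: "\<And>w. \<bar>x w\<bar> \<le> \<bar>x a\<bar>"
    by (rule finite_peak[of UNIV "\<lambda>w. \<bar>x w\<bar>"]) auto
  show ?thesis
  proof (cases "0 \<le> x a")
    case True
    then show ?thesis using that[of x a] assms a by simp
  next
    case False
    then show ?thesis using that[of "\<lambda>v. - x v" a] eigf_uminus[OF assms] a by simp
  qed
qed

section \<open>Neighbourhood sums in a graph and its complement\<close>

context adjacency
begin

lemma nb_sym: "w \<in> nb A v \<longleftrightarrow> v \<in> nb A w" using adj_sym by (auto simp: nb_def)
lemma nb_co: "nb (co A) v = UNIV - insert v (nb A v)" by (auto simp: nb_def co_def)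
lemma nb_irrefl [simp]: "v \<notin> nb A v" by (simp add: nb_def adj_irrefl)

lemma sum_split: "(\<Sum>w\<in>UNIV. f w) = f v + (\<Sum>w\<in>nb A v. f w) + (\<Sum>w\<in>nb (co A) v. f w)"
  for f :: "'v \<Rightarrow> real"
proof -
  have "UNIV = insert v (nb A v) \<union> nb (co A) v" by (auto simp: nb_co)
  then have "(\<Sum>w\<in>UNIV. f w) = (\<Sum>w\<in>insert v (nb A v) \<union> nb (co A) v. f w)" by simp
  also have "\<dots> = (\<Sum>w\<in>insert v (nb A v). f w) + (\<Sum>w\<in>nb (co A) v. f w)"
    by (rule sum.union_disjoint) (auto simp: nb_co)
  finally show ?thesis by simp
qed

lemma deg_co: "deg A v + deg (co A) v + 1 = CARD('v)"
proof -
  have "real (CARD('v)) = real (deg A v + deg (co A) v + 1)"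
    using sum_split[of "\<lambda>_. 1" v] by (simp add: deg_def)
  then show ?thesis by linarith
qed

lemma double_count:
  "(\<Sum>v\<in>UNIV. f v * (\<Sum>w\<in>nb A v. g w)) = (\<Sum>w\<in>UNIV. g w * (\<Sum>v\<in>nb A w. f v))"
  for f g :: "'v \<Rightarrow> real"
proof -
  have "(\<Sum>v\<in>UNIV. f v * (\<Sum>w\<in>nb A v. g w)) = (\<Sum>v\<in>UNIV. \<Sum>w\<in>UNIV. if A v w then f v * g w else 0)"
    by (simp add: sum_distrib_left nb_def sum.If_cases Int_def)
  also have "\<dots> = (\<Sum>w\<in>UNIV. \<Sum>v\<in>UNIV. if A v w then f v * g w else 0)" by (rule sum.swap)
  also have "\<dots> = (\<Sum>w\<in>UNIV. \<Sum>v\<in>UNIV. if A w v then g w * f v else 0)"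
    using adj_sym by (intro sum.cong) (auto simp: mult.commute)
  also have "\<dots> = (\<Sum>w\<in>UNIV. g w * (\<Sum>v\<in>nb A w. f v))"
    by (simp add: sum_distrib_left nb_def sum.If_cases Int_def)
  finally show ?thesis .
qed

end

section \<open>Degree bounds, opposition and flow for one eigenfunction\<close>

context tough_graph
begin

text \<open>Otherwise deleting the only neighbour, or any other vertex if \<open>v\<close> is
  isolated, would cut \<open>v\<close> off from the rest.\<close>

lemma deg_ge2: "2 \<le> deg A v"
proof (rule ccontr)
  assume "\<not> 2 \<le> deg A v"
  then have "card (nb A v) \<le> 1" by (simp add: deg_def)
  then obtain c where c: "nb A v \<subseteq> {c}"
    by (metis card_le_Suc0_iff_eq empty_subsetI finite insertCI One_nat_def subsetI insert_iff)
  \<comment> \<open>For an isolated \<open>v\<close> the vertex \<open>c\<close> may be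
    \<open>v\<close> itself; it is then replaced by some other vertex.\<close>
  define c' where "c' = (if c = v then (SOME z. z \<noteq> v) else c)"
  have ex: "\<exists>z. z \<noteq> v"
  proof (rule ccontr)
    assume "\<not> ?thesis" then have "(UNIV::'v set) = {v}" by auto
    then have "CARD('v) = 1" by (metis card.empty card.insert empty_iff finite.emptyI One_nat_def)
    with many show False by simp
  qed
  have c'v: "c' \<noteq> v" unfolding c'_def using someI_ex[OF ex] by auto
  have sub: "nb A v \<subseteq> {c'}" using c unfolding c'_def by (auto simp: adj_irrefl nb_def split: if_splits)
  have "insert c' {v} \<noteq> UNIV"
  proof
    assume "insert c' {v} = UNIV"
    then have "CARD('v) \<le> 2" by (metis card_2_iff c'v order_refl)
    with many show False by simp
  qed
  from tough[of c' "{v}", OF _ _ this] c'v obtain t where "t \<notin> {c',v}" "A v t" by auto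
  with sub show False by (auto simp: nb_def)
qed

lemma eigf_sum: "eigf A x \<Longrightarrow> (\<Sum>w\<in>nb A v. x w) = (real (deg A v) - 1) * x v"
  by (simp add: eigf_def)

lemma eigf_co_sum:
  assumes "eigf A x" shows "(\<Sum>w\<in>nb (co A) v. x w) = - real (deg A v) * x v"
  using sum_split[of x v] eigf_sum[OF assms, of v] assms by (simp add: eigf_def algebra_simps)

text \<open>By \<open>eigf_co_sum\<close> the left side is the absolute value of a sum of
  \<open>x\<close> over a set of vertices, and each sign has only mass 1 available.\<close>

lemma eigf_deg_bound:
  assumes "eigf A x" shows "real (deg A v) * \<bar>x v\<bar> \<le> 1"
  using eigf_subset_le[OF assms, of "nb (co A) v"] eigf_co_sum[OF assms, of v]
  by (simp add: abs_mult)

text \<open>The positive and negative masses around \<open>v\<close> differ by \<open>x v\<close>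
  times the nonnegative factor \<open>deg A v - 1\<close>, so the smaller mass is the one of
  opposite sign.\<close>

lemma opp_cases:
  assumes "eigf A x"
  shows "x v \<le> 0 \<Longrightarrow> opp A x v = (\<Sum>w\<in>nb A v. pos (x w))"
    and "0 \<le> x v \<Longrightarrow> opp A x v = (\<Sum>w\<in>nb A v. pos (- x w))"
    and "(\<Sum>w\<in>nb A v. pos (x w)) = opp A x v + (real (deg A v) - 1) * pos (x v)"
proof -
  have d: "real (deg A v) - 1 \<ge> 0" using deg_ge2[of v] by linarith
  have e: "(\<Sum>w\<in>nb A v. pos (x w)) - (\<Sum>w\<in>nb A v. pos (- x w)) = (real (deg A v) - 1) * x v"
    using eigf_sum[OF assms, of v] by (simp add: pos_diff flip: sum_subtractf)
  show 1: "x v \<le> 0 \<Longrightarrow> opp A x v = (\<Sum>w\<in>nb A v. pos (x w))"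
    using e mult_nonneg_nonpos[OF d, of "x v"] by (simp add: opp_def)
  show 2: "0 \<le> x v \<Longrightarrow> opp A x v = (\<Sum>w\<in>nb A v. pos (- x w))"
    using e mult_nonneg_nonneg[OF d, of "x v"] by (simp add: opp_def)
  show "(\<Sum>w\<in>nb A v. pos (x w)) = opp A x v + (real (deg A v) - 1) * pos (x v)"
    using 1 2 e by (cases "0 \<le> x v") auto
qed

text \<open>Double counting turns the positive neighbour masses into the sum of
  \<open>deg A v * pos (x v)\<close>; removing the part \<open>(deg A v - 1) * pos (x v)\<close> of
  \<open>opp_cases\<close> leaves the positive mass 1.\<close>

lemma opp_total:
  assumes "eigf A x" shows "(\<Sum>v\<in>UNIV. opp A x v) = 1"
proof -
  have "(\<Sum>v\<in>UNIV. opp A x v) + (\<Sum>v\<in>UNIV. (real (deg A v) - 1) * pos (x v))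
      = (\<Sum>v\<in>UNIV. 1 * (\<Sum>w\<in>nb A v. pos (x w)))"
    by (simp add: opp_cases(3)[OF assms] sum.distrib)
  also have "\<dots> = (\<Sum>v\<in>UNIV. pos (x v) * real (deg A v))"
    by (subst double_count) (simp add: deg_def)
  finally show ?thesis using eigf_pos[OF assms]
    by (simp add: algebra_simps sum_subtractf sum.distrib)
qed

lemma top_sum:
  assumes "eigf A x" shows "(\<Sum>w\<in>nb A a. x a - x w) = x a"
  using eigf_sum[OF assms, of a] by (simp add: sum_subtractf deg_def algebra_simps)

lemma top_le:
  assumes "eigf A x" and mx: "\<And>w. x w \<le> x a" and "S \<subseteq> nb A a"
  shows "(\<Sum>w\<in>S. x a - x w) \<le> x a"
proof -
  have "(\<Sum>w\<in>S. x a - x w) \<le> (\<Sum>w\<in>nb A a. x a - x w)"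
    by (rule sum_mono2) (use assms in auto)
  then show ?thesis by (simp add: top_sum[OF assms(1)])
qed

lemma top_nonneg:
  assumes "eigf A x" and "\<And>w. x w \<le> x a" and "w \<in> nb A a" shows "0 \<le> x w"
  using top_le[OF assms(1,2), of "{w}"] assms(3) by simp

lemma top_deg:
  assumes "eigf A x" and mx: "\<And>w. x w \<le> x a" shows "real (deg A a) * x a \<le> 1"
  using eigf_deg_bound[OF assms(1), of a] by (meson abs_ge_self mult_left_mono of_nat_0_le_iff order_trans)

text \<open>Each sign has total mass 1 and \<open>v\<close> contributes nothing to the opposite
  sign, so what the neighbours lack sits on the non-neighbours.\<close>

lemma opp_eq_co:
  assumes "eigf A x"
  shows "x v \<le> 0 \<Longrightarrow> opp A x v = 1 - (\<Sum>w\<in>nb (co A) v. pos (x w))"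
    and "0 \<le> x v \<Longrightarrow> opp A x v = 1 - (\<Sum>w\<in>nb (co A) v. pos (- x w))"
  using opp_cases[OF assms, of v] eigf_pos[OF assms]
    sum_split[of "\<lambda>w. pos (x w)" v] sum_split[of "\<lambda>w. pos (- x w)" v] by auto

lemma opp_co_ge:
  assumes "eigf A x" and "\<And>w. \<bar>x w\<bar> \<le> M"
  shows "1 - real (deg (co A) v) * M \<le> opp A x v"
proof (cases "x v \<le> 0")
  case True
  have "(\<Sum>w\<in>nb (co A) v. pos (x w)) \<le> (\<Sum>w\<in>nb (co A) v. M)"
    by (intro sum_mono order_trans[OF pos_le_abs assms(2)])
  with opp_eq_co(1)[OF assms(1) True] show ?thesis by (simp add: deg_def)
next
  case False
  have "(\<Sum>w\<in>nb (co A) v. pos (- x w)) \<le> (\<Sum>w\<in>nb (co A) v. M)"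
    by (intro sum_mono order_trans[OF pos_le_abs]) (simp add: assms(2))
  with opp_eq_co(2)[OF assms(1), of v] False show ?thesis by (simp add: deg_def)
qed

text \<open>Summing the eigenvalue equation over \<open>D\<close>, the differences inside \<open>D\<close> cancel, so the flow of
  \<open>x\<close> from \<open>D\<close> to the complement of \<open>insert c D\<close> is exactly \<open>card D * x c\<close>.\<close>
lemma flow_out:
  assumes ex: "eigf A x" and D: "D \<subseteq> nb A c"
    and top: "\<And>s t. s \<in> D \<Longrightarrow> t \<notin> insert c D \<Longrightarrow> x t \<le> x s"
    and s: "s \<in> D" and t: "t \<notin> insert c D" "A s t"
  shows "x s - real (card D) * x c \<le> x t"
proof -
  have cD: "c \<notin> D" using D nb_irrefl[of c] by auto
  have split: "x s = (x s - x c) + (\<Sum>w\<in>nb A s \<inter> D. x s - x w) + (\<Sum>w\<in>nb A s - insert c D. x s - x w)"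
    if "s \<in> D" for s
  proof -
    have "c \<in> nb A s" using that D nb_sym by blast
    then have "nb A s = insert c (nb A s \<inter> D \<union> (nb A s - insert c D))" by auto
    then have "(\<Sum>w\<in>nb A s. x s - x w) = (\<Sum>w\<in>insert c (nb A s \<inter> D \<union> (nb A s - insert c D)). x s - x w)"
      by simp
    also have "\<dots> = (x s - x c) + (\<Sum>w\<in>nb A s \<inter> D \<union> (nb A s - insert c D). x s - x w)"
      using cD by (subst sum.insert) auto
    also have "(\<Sum>w\<in>nb A s \<inter> D \<union> (nb A s - insert c D). x s - x w)
        = (\<Sum>w\<in>nb A s \<inter> D. x s - x w) + (\<Sum>w\<in>nb A s - insert c D. x s - x w)"
      by (rule sum.union_disjoint) auto
    finally show ?thesis using top_sum[OF ex, of s] by simp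
  qed
  let ?F = "\<lambda>s. \<Sum>w\<in>nb A s \<inter> D. x s - x w"
  have F: "?F s = (\<Sum>w\<in>D. if A s w then x s - x w else 0)" for s
    by (simp add: nb_def sum.If_cases Int_def conj_commute)
  have "sum ?F D = (\<Sum>s\<in>D. \<Sum>w\<in>D. if A s w then x s - x w else 0)" by (simp only: F)
  also have "\<dots> = (\<Sum>w\<in>D. \<Sum>s\<in>D. if A s w then x s - x w else 0)" by (rule sum.swap)
  also have "\<dots> = (\<Sum>w\<in>D. \<Sum>s\<in>D. - (if A w s then x w - x s else 0))"
    using adj_sym by (intro sum.cong refl) auto
  also have "\<dots> = - sum ?F D" by (simp only: F sum_negf)
  finally have "sum ?F D = 0" by simp
  moreover have "(\<Sum>s\<in>D. x s) = (\<Sum>s\<in>D. (x s - x c) + ?F s + (\<Sum>w\<in>nb A s - insert c D. x s - x w))"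
    by (rule sum.cong[OF refl]) (rule split)
  ultimately have "(\<Sum>s\<in>D. \<Sum>w\<in>nb A s - insert c D. x s - x w) = real (card D) * x c"
    by (simp add: sum.distrib sum_subtractf)
  \<comment> \<open>By \<open>top\<close> every outward drop is nonnegative, so the drop from
    \<open>s\<close> to \<open>t\<close> is at most the total flow.\<close>
  moreover have "(\<Sum>w\<in>nb A s - insert c D. x s - x w) \<le> (\<Sum>s\<in>D. \<Sum>w\<in>nb A s - insert c D. x s - x w)"
    by (rule member_le_sum[OF s]) (auto intro!: sum_nonneg top)
  moreover have "x s - x t \<le> (\<Sum>w\<in>nb A s - insert c D. x s - x w)"
    by (rule member_le_sum) (use t s top in \<open>auto simp: nb_def\<close>)
  ultimately show ?thesis by linarith
qed

end

section \<open>The peaks of the two eigenvectors\<close>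

locale tough_pair = tough_graph A + H: tough_graph "co A" for A :: "'v::finite \<Rightarrow> 'v \<Rightarrow> bool"
begin

lemma co_co_A [simp]: "co (co A) = A"
  by (auto simp: fun_eq_iff co_def adj_irrefl)

text \<open>Expand the product of the positive masses of \<open>x\<close> and \<open>y\<close>, both equal to 1, according to
  whether two vertices are equal, adjacent or non-adjacent.\<close>
lemma peak_sum_aux:
  assumes ex: "eigf A x" and ey: "eigf (co A) y" and M: "\<And>w. \<bar>x w\<bar> \<le> M" and Y: "\<And>w. \<bar>y w\<bar> \<le> Y"
    and u: "x u \<le> 0" "y u \<le> 0"
  shows "1 \<le> Y + M + (real CARD('v) - 2) * (Y * opp A x u + M * opp (co A) y u)"
proof -
  have pM: "pos (x w) \<le> M" and pY: "pos (y w) \<le> Y" for w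
    using M[of w] Y[of w] pos_le_abs[of "x w"] pos_le_abs[of "y w"] by linarith+
  \<comment> \<open>The mass 1 of \<open>x\<close>, split around \<open>v\<close> and weighted by
    \<open>pos (y v)\<close>. With \<open>n\<close> vertices,
    \<open>deg A v = (n - 2) - (deg (co A) v - 1)\<close>; the last part cancels after double
    counting over the complement.\<close>
  have pt: "pos (y v) * 1 = pos (y v) * opp A x v + (real CARD('v) - 2) * (pos (x v) * pos (y v))
      - pos (x v) * ((real (deg (co A) v) - 1) * pos (y v)) + pos (y v) * (\<Sum>w\<in>nb (co A) v. pos (x w))" for v
  proof -
    have "1 = pos (x v) + (opp A x v + (real (deg A v) - 1) * pos (x v)) + (\<Sum>w\<in>nb (co A) v. pos (x w))"
      using sum_split[of "\<lambda>w. pos (x w)" v] eigf_pos[OF ex] opp_cases(3)[OF ex, of v] by simp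
    moreover have "real CARD('v) = real (deg A v) + real (deg (co A) v) + 1"
      using deg_co[of v] by linarith
    ultimately have e: "1 = opp A x v + (real CARD('v) - 2) * pos (x v) - (real (deg (co A) v) - 1) * pos (x v)
      + (\<Sum>w\<in>nb (co A) v. pos (x w))" by (simp add: algebra_simps)
    show ?thesis by (subst e) (simp add: algebra_simps)
  qed
  have "1 = (\<Sum>v\<in>UNIV. pos (y v) * 1)" using eigf_pos[OF ey] by simp
  also have "\<dots> = (\<Sum>v\<in>UNIV. pos (y v) * opp A x v) + (real CARD('v) - 2) * (\<Sum>v\<in>UNIV. pos (x v) * pos (y v))
      - (\<Sum>v\<in>UNIV. pos (x v) * ((real (deg (co A) v) - 1) * pos (y v)))
      + (\<Sum>v\<in>UNIV. pos (y v) * (\<Sum>w\<in>nb (co A) v. pos (x w)))"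
    unfolding pt by (simp add: sum.distrib sum_subtractf sum_distrib_left)
  also have "(\<Sum>v\<in>UNIV. pos (y v) * (\<Sum>w\<in>nb (co A) v. pos (x w)))
      = (\<Sum>v\<in>UNIV. pos (x v) * opp (co A) y v)
        + (\<Sum>v\<in>UNIV. pos (x v) * ((real (deg (co A) v) - 1) * pos (y v)))"
    by (subst H.double_count) (simp add: H.opp_cases(3)[OF ey] distrib_left sum.distrib)
  finally have 1: "1 = (\<Sum>v\<in>UNIV. pos (y v) * opp A x v) + (\<Sum>v\<in>UNIV. pos (x v) * opp (co A) y v)
      + (real CARD('v) - 2) * (\<Sum>v\<in>UNIV. pos (x v) * pos (y v))" by simp
  have "(\<Sum>v\<in>UNIV. pos (y v) * opp A x v) \<le> (\<Sum>v\<in>UNIV. Y * opp A x v)"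
    by (intro sum_mono mult_right_mono pY) simp
  also have "\<dots> = Y" using opp_total[OF ex] by (simp flip: sum_distrib_left)
  finally have 2: "(\<Sum>v\<in>UNIV. pos (y v) * opp A x v) \<le> Y" .
  have "(\<Sum>v\<in>UNIV. pos (x v) * opp (co A) y v) \<le> (\<Sum>v\<in>UNIV. M * opp (co A) y v)"
    by (intro sum_mono mult_right_mono pM) simp
  also have "\<dots> = M" using H.opp_total[OF ey] by (simp flip: sum_distrib_left)
  finally have 3: "(\<Sum>v\<in>UNIV. pos (x v) * opp (co A) y v) \<le> M" .
  \<comment> \<open>At \<open>u\<close> itself the product vanishes. Around \<open>u\<close> one
    factor is bounded by its peak and the other sums to the opposition at \<open>u\<close>.\<close>
  have "(\<Sum>v\<in>nb A u. pos (x v) * pos (y v)) \<le> (\<Sum>v\<in>nb A u. Y * pos (x v))"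
    by (intro sum_mono) (metis mult.commute mult_right_mono pY pos_nonneg)
  moreover have "(\<Sum>v\<in>nb (co A) u. pos (x v) * pos (y v)) \<le> (\<Sum>v\<in>nb (co A) u. M * pos (y v))"
    by (intro sum_mono mult_right_mono pM) simp
  ultimately have "(\<Sum>v\<in>UNIV. pos (x v) * pos (y v)) \<le> Y * opp A x u + M * opp (co A) y u"
    unfolding sum_split[of _ u] using u
    by (simp add: opp_cases(1)[OF ex] H.opp_cases(1)[OF ey] sum_distrib_left)
  then have "(real CARD('v) - 2) * (\<Sum>v\<in>UNIV. pos (x v) * pos (y v))
     \<le> (real CARD('v) - 2) * (Y * opp A x u + M * opp (co A) y u)"
    using many by (intro mult_left_mono) auto
  with 1 2 3 show ?thesis by linarith
qed

text \<open>Summing \<open>peak_sum_aux\<close> over all \<open>u\<close>, with signs changed so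
  that both values at \<open>u\<close> are nonpositive, turns each opposition into its total 1 and
  gives \<open>n <= (2 * n - 2) * (M + Y)\<close> for \<open>n\<close> vertices.\<close>

lemma peak_sum:
  assumes ex: "eigf A x" and ey: "eigf (co A) y" and M: "\<And>w. \<bar>x w\<bar> \<le> M" and Y: "\<And>w. \<bar>y w\<bar> \<le> Y"
  shows "1/2 < M + Y"
proof -
  let ?n = "real CARD('v)"
  have "1 \<le> Y + M + (?n - 2) * (Y * opp A x u + M * opp (co A) y u)" for u
  proof -
    define x' where "x' = (if x u \<le> 0 then x else (\<lambda>v. - x v))"
    define y' where "y' = (if y u \<le> 0 then y else (\<lambda>v. - y v))"
    have "eigf A x'" "eigf (co A) y'" "\<And>w. \<bar>x' w\<bar> \<le> M" "\<And>w. \<bar>y' w\<bar> \<le> Y" "x' u \<le> 0" "y' u \<le> 0"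
      using assms by (auto simp: x'_def y'_def eigf_uminus eigf_uminus)
    from peak_sum_aux[OF this] show ?thesis
      by (auto simp: x'_def y'_def opp_uminus opp_uminus split: if_splits)
  qed
  then have "(\<Sum>u\<in>(UNIV::'v set). 1) \<le> (\<Sum>u\<in>UNIV. Y + M + (?n - 2) * (Y * opp A x u + M * opp (co A) y u))"
    by (intro sum_mono)
  also have "\<dots> = ?n * (Y + M) + (?n - 2) * (Y * (\<Sum>u\<in>UNIV. opp A x u) + M * (\<Sum>u\<in>UNIV. opp (co A) y u))"
    by (simp add: sum.distrib flip: sum_distrib_left)
  finally have "?n \<le> (2 * ?n - 2) * (M + Y)"
    by (simp add: opp_total[OF ex] H.opp_total[OF ey] algebra_simps)
  show ?thesis
  proof (rule ccontr)
    assume "\<not> ?thesis"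
    then have "(2 * ?n - 2) * (M + Y) \<le> (2 * ?n - 2) * (1/2)"
      using many by (intro mult_left_mono) auto
    with \<open>?n \<le> _\<close> show False by simp
  qed
qed

text \<open>For smaller \<open>Y\<close> the peak of \<open>x\<close> would have degree 2, its value
  being the sum of those at its two neighbours. Little \<open>y\<close>-opposition remains for
  these, so their degrees are large and their values of \<open>x\<close> too small.\<close>

lemma peak_lower_aux:
  assumes ex: "eigf A x" and ey: "eigf (co A) y" and M: "\<And>w. \<bar>x w\<bar> \<le> M" and Y: "\<And>w. \<bar>y w\<bar> \<le> Y"
    and a: "x a = M" and ya: "y a \<le> 0"
  shows "2/13 \<le> Y"
proof (rule ccontr)
  assume "\<not> ?thesis"
  then have Yl: "Y < 2/13" by simp
  have Y0: "0 \<le> Y" using Y[of a] by linarith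
  \<comment> \<open>Here 9/26 = 1/2 - 2/13 exceeds 1/3, which rules out degree 3 or more at
    \<open>a\<close>.\<close>
  have Mg: "9/26 < M" using peak_sum[OF ex ey M Y] Yl by simp
  have "real (deg A a) * M \<le> 1" using eigf_deg_bound[OF ex, of a] a M[of a] by simp
  have "deg A a \<le> 2"
  proof (rule ccontr)
    assume "\<not> ?thesis"
    then have "3 * M \<le> real (deg A a) * M" using Mg by (intro mult_right_mono) auto
    with \<open>_ \<le> 1\<close> Mg show False by simp
  qed
  with deg_ge2[of a] have d: "deg A a = 2" by simp
  then obtain w1 w2 where w: "nb A a = {w1, w2}" "w1 \<noteq> w2"
    unfolding deg_def by (meson card_2_iff)
  have xs: "x w1 + x w2 = M" using eigf_sum[OF ex, of a] w d a by simp
  have aw: "a \<noteq> w1" "a \<noteq> w2" using w nb_irrefl[of a] by auto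
  have oa: "opp (co A) y a = 1 - (pos (y w1) + pos (y w2))"
    using H.opp_eq_co(1)[OF ey ya] w by simp
  have "(\<Sum>v\<in>{a,w1,w2}. opp (co A) y v) \<le> (\<Sum>v\<in>UNIV. opp (co A) y v)"
    by (rule sum_mono2) auto
  then have "opp (co A) y a + opp (co A) y w1 + opp (co A) y w2 \<le> 1"
    using H.opp_total[OF ey] aw w(2) by simp
  moreover have "pos (y w1) \<le> Y" "pos (y w2) \<le> Y"
    using order_trans[OF pos_le_abs Y] by blast+
  ultimately have os: "opp (co A) y w1 + opp (co A) y w2 \<le> 2 * Y" using oa by linarith
  have nn: "0 \<le> opp (co A) y w1" "0 \<le> opp (co A) y w2" by simp_all
  have dY: "1 - real (deg A w) * Y \<le> opp (co A) y w" for w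
    using H.opp_co_ge[OF ey Y, of w] by simp
  have d5: "5 \<le> deg A w" if "opp (co A) y w \<le> 2 * Y" for w
  proof (rule ccontr)
    assume "\<not> ?thesis"
    then have "real (deg A w) * Y \<le> 4 * Y" using Y0 by (intro mult_right_mono) auto
    with dY[of w] that Yl show False by linarith
  qed
  have d1: "5 \<le> deg A w1" and d2: "5 \<le> deg A w2" using os nn d5 by (smt (verit))+
  \<comment> \<open>A degree sum of at most 11 would give \<open>2 <= 13 * Y\<close>; this is the
    origin of 2/13.\<close>
  have d12: "12 \<le> deg A w1 + deg A w2"
  proof (rule ccontr)
    assume "\<not> ?thesis"
    then have "real (deg A w1 + deg A w2) * Y \<le> 11 * Y" using Y0 by (intro mult_right_mono) auto
    then have "real (deg A w1) * Y + real (deg A w2) * Y \<le> 11 * Y" by (simp add: distrib_right)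
    with dY[of w1] dY[of w2] os Yl show False by linarith
  qed
  have xk: "x w \<le> 1 / real k" if "k \<le> deg A w" "0 < k" for w k
  proof -
    have "real k * \<bar>x w\<bar> \<le> real (deg A w) * \<bar>x w\<bar>" using that by (intro mult_right_mono) auto
    with eigf_deg_bound[OF ex, of w] have "real k * \<bar>x w\<bar> \<le> 1" by linarith
    moreover have "real k * x w \<le> real k * \<bar>x w\<bar>" by (intro mult_left_mono) auto
    ultimately have "real k * x w \<le> 1" by linarith
    with that show ?thesis by (simp add: field_simps)
  qed
  \<comment> \<open>The values at \<open>w1\<close> and \<open>w2\<close> then sum to at most 1/7 +
    1/5 or 1/6 + 1/6, both below 9/26.\<close>
  consider "7 \<le> deg A w1" | "7 \<le> deg A w2" | "6 \<le> deg A w1" "6 \<le> deg A w2"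
    using d1 d2 d12 by linarith
  then show False
  proof cases
    case 1 with xk[of 7 w1] xk[of 5 w2] d2 xs Mg show False by simp
  next
    case 2 with xk[of 7 w2] xk[of 5 w1] d1 xs Mg show False by simp
  next
    case 3 with xk[of 6 w1] xk[of 6 w2] xs Mg show False by simp
  qed
qed

lemma peak_lower:
  assumes ex: "eigf A x" and ey: "eigf (co A) y" and M: "\<And>w. \<bar>x w\<bar> \<le> M" and Y: "\<And>w. \<bar>y w\<bar> \<le> Y"
    and a: "x a = M"
  shows "2/13 \<le> Y"
proof (cases "y a \<le> 0")
  case True
  then show ?thesis using peak_lower_aux[OF assms] by simp
next
  case False
  then show ?thesis
    using peak_lower_aux[OF ex eigf_uminus[OF ey] M, of Y a] Y a by simp
qed

text \<open>The degrees of \<open>u\<close> in the two graphs sum to at least 31: a large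
  \<open>x u\<close> forces a small degree in \<open>A\<close>, hence a large one in the
  complement.\<close>

lemma large_imp_other_small:
  assumes ex: "eigf A x" and ey: "eigf (co A) y" and u: "1 / real j < \<bar>x u\<bar>" and j: "0 < j" "j < 32"
  shows "\<bar>y u\<bar> \<le> 1 / (32 - real j)"
proof -
  have "deg A u < j"
  proof (rule ccontr)
    assume "\<not> ?thesis"
    then have "real j * \<bar>x u\<bar> \<le> real (deg A u) * \<bar>x u\<bar>" by (intro mult_right_mono) auto
    with eigf_deg_bound[OF ex, of u] have "real j * \<bar>x u\<bar> \<le> 1" by linarith
    with u j show False by (simp add: field_simps)
  qed
  with deg_co[of u] many have "32 - real j \<le> real (deg (co A) u)" by linarith
  then have "(32 - real j) * \<bar>y u\<bar> \<le> real (deg (co A) u) * \<bar>y u\<bar>" by (intro mult_right_mono) auto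
  with H.eigf_deg_bound[OF ey, of u] have "(32 - real j) * \<bar>y u\<bar> \<le> 1" by linarith
  with j show ?thesis by (simp add: field_simps)
qed

text \<open>Few non-neighbours of \<open>c\<close> make \<open>x c\<close> small. Flow out of
  \<open>{a}\<close> and then \<open>{a, s2}\<close> yields two more high vertices of
  \<open>x\<close>, and the \<open>y\<close>-opposition at the three is at least 12/11.\<close>

lemma adjacent_peaks:
  assumes ex: "eigf A x" and ey: "eigf (co A) y" and M: "\<And>w. \<bar>x w\<bar> \<le> M" and Y: "\<And>w. \<bar>y w\<bar> \<le> Y"
    and a: "x a = M" and c: "y c = Y" and ac: "A a c" and M2: "2/13 \<le> M"
  shows False
proof -
  have Y2: "2/13 \<le> Y" by (rule peak_lower[OF ex ey M Y a])
  have MY: "1/2 < M + Y" by (rule peak_sum[OF ex ey M Y])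
  have xM: "x w \<le> x a" for w using M[of w] a by linarith
  have yY: "y w \<le> y c" for w using Y[of w] c by linarith
  define B where "B = nb (co A) c"
  define k where "k = deg (co A) c"
  define g where "g = x c"
  have kB: "card B = k" by (simp add: k_def B_def deg_def)
  have k2: "2 \<le> k" unfolding k_def by (rule H.deg_ge2)
  have kY: "real k * Y \<le> 1" using H.top_deg[OF ey yY] c by (simp add: k_def)
  have k6: "k \<le> 6"
  proof (rule ccontr)
    assume "\<not> ?thesis"
    then have "7 * Y \<le> real k * Y" using Y2 by (intro mult_right_mono) auto
    with kY Y2 show False by linarith
  qed
  have g0: "0 \<le> g" unfolding g_def using top_nonneg[OF ex xM] ac by (simp add: nb_def)
  have Bsum: "(\<Sum>v\<in>B. x v) = - (real (deg A c) * g)"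
    unfolding B_def g_def using eigf_co_sum[OF ex, of c] by simp
  have dge: "31 - real k \<le> real (deg A c)" using deg_co[of c] many unfolding k_def by linarith
  \<comment> \<open>Two vertices of \<open>B\<close> cannot both have small \<open>y\<close>, hence
    by \<open>large_imp_other_small\<close> not both large \<open>x\<close>.\<close>
  have two: "2 * Y - \<bar>y u\<bar> - \<bar>y v\<bar> \<le> Y" if "u \<in> B" "v \<in> B" "u \<noteq> v" for u v
    using H.top_le[OF ey yY, of "{u,v}"] that c by (simp add: B_def)
  have "\<exists>u\<in>B. \<forall>v\<in>B - {u}. - (1/17) \<le> x v"
  proof (rule ccontr)
    assume H: "\<not> ?thesis"
    have "B \<noteq> {}" using kB k2 by auto
    then obtain u0 where "u0 \<in> B" by auto
    with H obtain u where u: "u \<in> B" "x u < - (1/17)" by force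
    from H u(1) have "\<not> (\<forall>v\<in>B - {u}. - (1/17) \<le> x v)" by blast
    then obtain v where v: "v \<in> B" "v \<noteq> u" "x v < - (1/17)" by force
    have "\<bar>y u\<bar> \<le> 1/15" "\<bar>y v\<bar> \<le> 1/15" using large_imp_other_small[OF ex ey, of 17] u v by auto
    with two[OF u(1) v(1)] v(2) Y2 show False by simp
  qed
  then obtain u where u: "u \<in> B" "\<And>v. v \<in> B - {u} \<Longrightarrow> - (1/17) \<le> x v" by auto
  have "(\<Sum>v\<in>B - {u}. - (1/17)) \<le> (\<Sum>v\<in>B - {u}. x v)" by (rule sum_mono) (rule u)
  then have "- ((real k - 1) / 17) \<le> (\<Sum>v\<in>B - {u}. x v)"
    using u(1) kB k2 by (simp add: of_nat_diff diff_divide_distrib)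
  moreover have "(\<Sum>v\<in>B. x v) = x u + (\<Sum>v\<in>B - {u}. x v)" using u(1) by (simp add: sum.remove)
  moreover have "- M \<le> x u" using M[of u] by linarith
  moreover have "(31 - real k) * g \<le> real (deg A c) * g" using dge g0 by (rule mult_right_mono)
  ultimately have gb: "(31 - real k) * g \<le> M + (real k - 1) / 17" using Bsum by linarith
  have "k = 2 \<or> k = 3 \<or> k = 4 \<or> k = 5 \<or> k = 6" using k2 k6 by auto
  \<comment> \<open>The first bound will limit the degrees of the three high vertices to 7, the
    second excludes such vertices from \<open>B\<close>, and the third makes \<open>y\<close> at
    most 1/22 on their neighbours other than \<open>c\<close>.\<close>
  then have num: "1/8 < M - 3 * g \<and> (real k - 1) / 20 < M - 3 * g \<and> 1/10 < M - 6 * g"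
    using gb kY MY M2 by (elim disjE) (intro conjI; simp; linarith)+
  \<comment> \<open>The sum of \<open>x\<close> over \<open>B\<close> is at most 0, so a high vertex
    of \<open>B\<close> forces another below -1/20; both have small \<open>y\<close>, against
    \<open>two\<close>.\<close>
  have near: False if v: "v \<in> B" "1/10 < x v" "(real k - 1) / 20 < x v" for v
  proof -
    have "\<exists>u\<in>B - {v}. x u < - (1/20)"
    proof (rule ccontr)
      assume "\<not> ?thesis"
      then have "(\<Sum>u\<in>B - {v}. - (1/20)) \<le> (\<Sum>u\<in>B - {v}. x u)" by (intro sum_mono) force
      then have "- ((real k - 1) / 20) \<le> (\<Sum>u\<in>B - {v}. x u)"
        using v(1) kB k2 by (simp add: of_nat_diff diff_divide_distrib)
      moreover have "(\<Sum>u\<in>B. x u) = x v + (\<Sum>u\<in>B - {v}. x u)" using v(1) by (simp add: sum.remove)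
      moreover have "0 \<le> real (deg A c) * g" using g0 by simp
      ultimately show False using Bsum v(3) by linarith
    qed
    then obtain u where u: "u \<in> B" "u \<noteq> v" "x u < - (1/20)" by auto
    have "\<bar>y u\<bar> \<le> 1/12" "\<bar>y v\<bar> \<le> 1/22"
      using large_imp_other_small[OF ex ey, of 20 u] large_imp_other_small[OF ex ey, of 10 v] u v by auto
    with two[OF u(1) v(1) u(2)] Y2 show False by linarith
  qed
  have nbc: "v \<in> nb A c" if "v \<noteq> c" "M - 3 * g \<le> x v" for v
  proof (rule ccontr)
    assume "\<not> ?thesis"
    then have "v \<in> B" using that by (simp add: B_def nb_co)
    with near[of v] that num show False by linarith
  qed
  \<comment> \<open>Connectedness without \<open>c\<close> gives an edge leaving \<open>D\<close>,
    and \<open>flow_out\<close> bounds the drop along it. Choosing the highest vertex outside allows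
    the step to be repeated.\<close>
  have grow: "\<exists>s. s \<notin> insert c D \<and> (\<forall>t. t \<notin> insert c D \<longrightarrow> x t \<le> x s)
       \<and> (\<exists>r\<in>D. x r - real (card D) * g \<le> x s)"
    if D: "D \<subseteq> nb A c" "D \<noteq> {}" "card D \<le> 2"
      and top: "\<And>s t. s \<in> D \<Longrightarrow> t \<notin> insert c D \<Longrightarrow> x t \<le> x s" for D
  proof -
    have "card (insert c D) \<le> 3" using D(3) card_insert_le_m1[of 3 D c] by simp
    then have nU: "insert c D \<noteq> UNIV" using many by auto
    have cD: "c \<notin> D" using D(1) nb_irrefl[of c] by auto
    obtain r t where rt: "r \<in> D" "t \<notin> insert c D" "A r t" using tough[OF cD D(2) nU] by auto
    have fl: "x r - real (card D) * g \<le> x t" unfolding g_def by (rule flow_out[OF ex D(1) top rt])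
    obtain s where s: "s \<in> - insert c D" "\<And>t. t \<in> - insert c D \<Longrightarrow> x t \<le> x s"
      using nU by (rule_tac finite_peak[of "- insert c D" x]) auto
    then have "x r - real (card D) * g \<le> x s" using fl rt(2) by fastforce
    with s rt(1) show ?thesis by blast
  qed
  have a_c: "a \<in> nb A c" using ac adj_sym by (simp add: nb_def)
  obtain s2 where s2: "s2 \<noteq> c" "s2 \<noteq> a" "\<And>t. t \<noteq> c \<Longrightarrow> t \<noteq> a \<Longrightarrow> x t \<le> x s2" "M - g \<le> x s2"
    using grow[of "{a}"] a_c xM a by auto
  have s2c: "s2 \<in> nb A c" using nbc[OF s2(1)] s2(4) g0 by linarith
  have s2M: "x s2 \<le> M" using xM a by metis
  obtain s3 where s3: "s3 \<noteq> c" "s3 \<noteq> a" "s3 \<noteq> s2" "\<And>t. t \<noteq> c \<Longrightarrow> t \<noteq> a \<Longrightarrow> t \<noteq> s2 \<Longrightarrow> x t \<le> x s3"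
      "x s2 - 2 * g \<le> x s3"
  proof -
    have c2: "card {a, s2} = 2" using s2(2) by simp
    have top2: "x t \<le> x s" if "s \<in> {a, s2}" "t \<notin> insert c {a, s2}" for s t
      using that xM s2(3) by auto
    have D2: "{a, s2} \<subseteq> nb A c" using a_c s2c by simp
    obtain s r where "s \<notin> insert c {a, s2}" "\<And>t. t \<notin> insert c {a, s2} \<Longrightarrow> x t \<le> x s"
      "r \<in> {a, s2}" "x r - 2 * g \<le> x s"
      using grow[OF D2 _ _ top2, unfolded c2] by force
    then show ?thesis using s2M a by (intro that[of s]) auto
  qed
  have s3c: "s3 \<in> nb A c" using nbc[OF s3(1)] s3(5) s2(4) g0 by linarith
  define D where "D = {a, s2, s3}"
  have D3: "card D = 3" using s2 s3 by (simp add: D_def)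
  have Dc: "D \<subseteq> nb A c" using a_c s2c s3c by (simp add: D_def)
  have Dx: "M - 3 * g \<le> x s" if "s \<in> D" for s
    using that a g0 s2(4) s3(5) by (auto simp: D_def)
  have Dtop: "x t \<le> x s" if "s \<in> D" "t \<notin> insert c D" for s t
    using that xM s2(3) s3(4) by (auto simp: D_def)
  have Dn: "1/10 < x t" if "s \<in> D" "A s t" "t \<noteq> c" for s t
  proof (cases "t \<in> D")
    case True
    then show ?thesis using Dx num by force
  next
    case False
    then have "x s - 3 * g \<le> x t"
      using flow_out[OF ex Dc Dtop that(1), of t] that D3 by (simp add: g_def)
    with Dx[OF that(1)] num show ?thesis by linarith
  qed
  \<comment> \<open>Opposition is 1 minus the opposite-sign mass on \<open>c\<close> and on the at
    most 6 vertices of \<open>R\<close>. For \<open>y s > 0\<close> the vertex \<open>c\<close> does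
    not count; for \<open>3 <= k\<close> the bound \<open>Y <= 1/3\<close> suffices.\<close>
  have o4: "4/11 \<le> opp (co A) y s" if s: "s \<in> D" for s
  proof -
    have "deg A s < 8"
    proof (rule ccontr)
      assume "\<not> ?thesis"
      then have "8 * \<bar>x s\<bar> \<le> real (deg A s) * \<bar>x s\<bar>" by (intro mult_right_mono) auto
      with eigf_deg_bound[OF ex, of s] Dx[OF s] num show False by linarith
    qed
    have cs: "c \<in> nb A s" using s Dc nb_sym by blast
    define R where "R = nb A s - {c}"
    have R6: "real (card R) \<le> 6" using \<open>deg A s < 8\<close> cs by (simp add: R_def deg_def)
    have spl: "(\<Sum>w\<in>nb A s. f w) = f c + (\<Sum>w\<in>R. f w)" for f :: "'v \<Rightarrow> real"
      using cs by (simp add: R_def sum.remove)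
    have Rx: "1/10 < x w" if "w \<in> R" for w using Dn[OF s] that by (auto simp: R_def nb_def)
    have Ry: "\<bar>y w\<bar> \<le> 1/22" if "w \<in> R" for w using large_imp_other_small[OF ex ey, of 10 w] Rx[OF that] by auto
    have bnd: "(\<Sum>w\<in>R. f w) \<le> 6 * b" if "\<And>w. w \<in> R \<Longrightarrow> f w \<le> b" "0 \<le> b" for f :: "'v \<Rightarrow> real" and b
    proof -
      have "(\<Sum>w\<in>R. f w) \<le> real (card R) * b" using sum_bounded_above[of R f b] that by simp
      also have "\<dots> \<le> 6 * b" using R6 that(2) by (rule mult_right_mono)
      finally show ?thesis .
    qed
    consider "0 < y s" | "y s \<le> 0" "k = 2" | "y s \<le> 0" "3 \<le> k" using k2 by linarith
    then show ?thesis
    proof cases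
      case 1
      have "(\<Sum>w\<in>R. pos (- y w)) \<le> 6 * (1/22)"
        using Ry by (intro bnd order_trans[OF pos_le_abs]) auto
      then show ?thesis using H.opp_eq_co(2)[OF ey, of s] 1 c Y2 by (simp add: spl)
    next
      case 3
      have "(\<Sum>w\<in>R. pos (y w)) \<le> 6 * (1/22)"
        using Ry by (intro bnd order_trans[OF pos_le_abs]) auto
      moreover have "3 * Y \<le> real k * Y" using 3 Y2 by (intro mult_right_mono) auto
      then have "3 * Y \<le> 1" using kY by linarith
      ultimately show ?thesis using H.opp_eq_co(1)[OF ey, of s] 3 c Y2 by (simp add: spl)
    next
      case 2
      have Y12: "Y \<le> 1/2" using kY 2 by simp
      \<comment> \<open>With only \<open>Y <= 1/2\<close> the bound 1/22 is too weak. As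
        \<open>w\<close> is adjacent to \<open>c\<close>, the value \<open>Y\<close> enters the sum
        around \<open>w\<close> and improves it; the opposition is then at least 8/11 times
        \<open>1 - Y\<close>.\<close>
      have "pos (y w) \<le> (1 - Y) / 22" if w: "w \<in> R" for w
      proof (cases "0 \<le> y w")
        case True
        have "w \<notin> B" using near[of w] Rx[OF w] 2 by auto
        then have "w \<in> nb A c" using w by (auto simp: B_def nb_co R_def)
        then have cw: "c \<in> nb A w" using nb_sym by blast
        have "- (\<Sum>v\<in>nb A w - {c}. y v) \<le> 1"
          using eigf_subset_le[OF ey, of "nb A w - {c}"] by linarith
        moreover have "(\<Sum>v\<in>nb A w. y v) = Y + (\<Sum>v\<in>nb A w - {c}. y v)"
          using cw c by (simp add: sum.remove)
        moreover have "(\<Sum>v\<in>nb A w. y v) = - (real (deg (co A) w) * y w)"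
          using H.eigf_co_sum[OF ey, of w] by simp
        ultimately have e: "real (deg (co A) w) * y w \<le> 1 - Y" by linarith
        have "deg A w < 10"
        proof (rule ccontr)
          assume "\<not> ?thesis"
          then have "10 * \<bar>x w\<bar> \<le> real (deg A w) * \<bar>x w\<bar>" by (intro mult_right_mono) auto
          with eigf_deg_bound[OF ex, of w] Rx[OF w] show False by linarith
        qed
        with deg_co[of w] many have "22 \<le> real (deg (co A) w)" by linarith
        then have "22 * y w \<le> real (deg (co A) w) * y w" using True by (intro mult_right_mono) auto
        with e True show ?thesis by simp
      next
        case False
        then show ?thesis using Y12 by simp
      qed
      then have "(\<Sum>w\<in>R. pos (y w)) \<le> 6 * ((1 - Y) / 22)" using Y12 by (intro bnd) auto
      then show ?thesis using H.opp_eq_co(1)[OF ey, of s] 2 c Y2 Y12 by (simp add: spl)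
    qed
  qed
  have "(\<Sum>s\<in>D. 4/11) \<le> (\<Sum>s\<in>D. opp (co A) y s)" by (rule sum_mono) (rule o4)
  also have "\<dots> \<le> (\<Sum>s\<in>UNIV. opp (co A) y s)" by (rule sum_mono2) auto
  finally show False using H.opp_total[OF ey] D3 by simp
qed

lemma no_eigenfunction_pair:
  assumes "eigf A x" and "eigf (co A) y" shows False
proof -
  obtain x' a where x: "eigf A x'" "\<And>w. \<bar>x' w\<bar> \<le> x' a" using positive_peak[OF assms(1)] by metis
  obtain y' c where y: "eigf (co A) y'" "\<And>w. \<bar>y' w\<bar> \<le> y' c" using positive_peak[OF assms(2)] by metis
  interpret S: tough_pair "co A"
    by (rule tough_pair.intro) (simp_all add: tough_graph_axioms H.tough_graph_axioms)
  have Y: "2/13 \<le> y' c" by (rule peak_lower[OF x(1) y(1) x(2) y(2) refl]) 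
  have M: "2/13 \<le> x' a" by (rule S.peak_lower[of y' x']) (use x y in auto)
  \<comment> \<open>As 2/13 > 1/7, at a common peak \<open>y'\<close> would be at most 1/25.\<close>
  have "a \<noteq> c"
  proof
    assume ac: "a = c"
    have "\<bar>y' c\<bar> \<le> 1 / (32 - real 7)" using large_imp_other_small[OF x(1) y(1), of 7 c] M ac by simp
    with Y show False by simp
  qed
  then consider "A a c" | "co A c a" using adj_sym by (auto simp: co_def)
  then show False
  proof cases
    case 1 show False by (rule adjacent_peaks[OF x(1) y(1) x(2) y(2) refl refl 1 M])
  next
    \<comment> \<open>The setting is symmetric under complement, so \<open>x'\<close> and
      \<open>y'\<close> exchange roles.\<close>
    case 2 show False by (rule S.adjacent_peaks[of y' x', OF y(1) _ y(2) x(2) refl refl 2 Y]) (simp add: x)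
  qed
qed

end

section \<open>From the eigenvalue list to eigenvectors\<close>

lemma poly_det_eval: "poly (det M) z = det (\<chi> i j. poly (M $ i $ j) z)"
  for M :: "real poly^'n^'n"
  by (simp add: det_def poly_sum poly_prod)

lemma poly_charpoly: "poly (charpoly A) z = det (mat z - A)"
proof -
  have "(\<chi> i j. poly ((mat [:0, 1:] - (\<chi> i j. [:A $ i $ j:])) $ i $ j) z) = mat z - A"
    by (simp add: vec_eq_iff mat_def)
  then show ?thesis unfolding charpoly_def poly_det_eval by (rule arg_cong)
qed

lemma det_eq_0_iff_kernel: "det A = 0 \<longleftrightarrow> (\<exists>v. v \<noteq> 0 \<and> A *v v = 0)" for A :: "real^'n^'n"
  using invertible_det_nz[of A] invertible_left_inverse[of A] matrix_left_invertible_ker[of A]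
  by blast

lemma mat_mult_vec: "mat z *v v = z *\<^sub>R v" for v :: "real^'n"
proof -
  have "(\<Sum>j\<in>UNIV. (if i = j then z else 0) * v $ j) = z * v $ i" for i
    by (simp add: if_distrib if_distribR cong: if_cong)
  then show ?thesis by (simp add: vec_eq_iff matrix_vector_mult_def mat_def)
qed

lemma charpoly_root_iff: "poly (charpoly A) z = 0 \<longleftrightarrow> (\<exists>v. v \<noteq> 0 \<and> A *v v = z *\<^sub>R v)"
  unfolding poly_charpoly det_eq_0_iff_kernel
  by (auto simp: matrix_vector_mult_diff_rdistrib mat_mult_vec)

text \<open>Replacing two rows of the identity by independent eigenvectors \<open>u\<close>, \<open>f\<close> gives an invertible
  \<open>P\<close> for which two rows of \<open>P (X I - A)\<close> are multiples of \<open>X - a\<close> and \<open>X - b\<close>.\<close>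
lemma charpoly_two_factors:
  fixes A :: "real^'n^'n"
  assumes sym: "transpose A = A" and u: "A *v u = a *\<^sub>R u" and f: "A *v f = b *\<^sub>R f"
    and indep: "u $ i * f $ j \<noteq> u $ j * f $ i"
  obtains c q where "c \<noteq> 0" "smult c (charpoly A) = [:- a, 1:] * [:- b, 1:] * q"
proof -
  have ij: "i \<noteq> j" using indep by auto
  define P :: "real^'n^'n" where "P = (\<chi> k. if k = i then u else if k = j then f else axis k 1)"
  define q where "q = det (\<chi> k l. if k = i then [:u $ l:] else if k = j then [:f $ l:]
      else (mat [:0, 1:] - (\<chi> i j. [:A $ i $ j:])) $ k $ l)"
  have rows: "v v* (mat z - A) = (z - c) *\<^sub>R v" if "A *v v = c *\<^sub>R v" for v c z
  proof -
    have "transpose (mat z - A) = mat z - A"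
      using sym by (simp add: transpose_def vec_eq_iff mat_def)
    then have "v v* (mat z - A) = (mat z - A) *v v"
      by (metis transpose_matrix_vector)
    then show ?thesis using that
      by (simp add: matrix_vector_mult_diff_rdistrib mat_mult_vec scaleR_diff_left)
  qed
  \<comment> \<open>The unit rows make a kernel vector vanish outside \<open>i\<close> and
    \<open>j\<close>, and the nonzero 2 by 2 minor in \<open>indep\<close> kills these two
    entries.\<close>
  have "det P \<noteq> 0"
  proof
    assume "det P = 0"
    then obtain v where v: "v \<noteq> 0" "P *v v = 0" using det_eq_0_iff_kernel by blast
    then have Pv: "P $ k \<bullet> v = 0" for k by (metis matrix_vector_mul_component zero_index)
    have v0: "v $ k = 0" if "k \<noteq> i" "k \<noteq> j" for k
      using Pv[of k] that by (simp add: P_def inner_axis' )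
    have e: "w \<bullet> v = w $ i * v $ i + w $ j * v $ j" for w :: "real^'n"
    proof -
      have "(\<Sum>k\<in>UNIV. w $ k * v $ k) = (\<Sum>k\<in>{i, j}. w $ k * v $ k)"
        using v0 by (intro sum.mono_neutral_right) auto
      then show ?thesis using ij by (simp add: inner_vec_def)
    qed
    have "u $ i * v $ i + u $ j * v $ j = 0" "f $ i * v $ i + f $ j * v $ j = 0"
      using Pv[of i] Pv[of j] ij by (simp_all add: P_def e)
    then have "(u $ i * f $ j - u $ j * f $ i) * v $ i = 0" "(u $ i * f $ j - u $ j * f $ i) * v $ j = 0"
      by algebra+
    then have "v $ i = 0" "v $ j = 0" using indep by auto
    then have "v = 0" using v0 by (metis vec_eq_iff zero_index)
    with v show False by simp
  qed
  moreover have "poly (smult (det P) (charpoly A)) z = poly ([:- a, 1:] * [:- b, 1:] * q) z" for z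
  proof -
    have pq: "poly q z = det (\<chi> k. if k = i then u else if k = j then f else (mat z - A) $ k)"
      unfolding q_def poly_det_eval by (rule arg_cong[where f=det]) (simp add: vec_eq_iff mat_def)
    have "P ** (mat z - A) = (\<chi> k. if k = i then (z - a) *s u
        else if k = j then (z - b) *s f else (mat z - A) $ k)"
    proof -
      have "(P ** (mat z - A)) $ k = P $ k v* (mat z - A)" for k
        by (simp add: vec_eq_iff matrix_matrix_mult_def vector_matrix_mult_def mult.commute)
      moreover have "axis k 1 v* (mat z - A) = (mat z - A) $ k" for k
        by (simp add: vec_eq_iff vector_matrix_mult_def axis_def if_distrib if_distribR cong: if_cong)
      ultimately show ?thesis
        using rows[OF u] rows[OF f] by (simp add: vec_eq_iff P_def left_diff_distrib)
    qed
    then have "det P * det (mat z - A) = det (\<chi> k. if k = i then (z - a) *s u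
        else if k = j then (z - b) *s f else (mat z - A) $ k)"
      by (metis det_mul)
    also have "\<dots> = (z - a) * det (\<chi> k. if k = i then u
        else if k = j then (z - b) *s f else (mat z - A) $ k)"
      by (rule det_row_mul)
    also have "(\<chi> k. if k = i then u else if k = j then (z - b) *s f else (mat z - A) $ k)
       = (\<chi> k. if k = j then (z - b) *s f else if k = i then u else (mat z - A) $ k)"
      using ij by (auto simp: vec_eq_iff)
    also have "det \<dots> = (z - b) * det (\<chi> k. if k = j then f else if k = i then u else (mat z - A) $ k)"
      by (rule det_row_mul)
    also have "(\<chi> k. if k = j then f else if k = i then u else (mat z - A) $ k)
       = (\<chi> k. if k = i then u else if k = j then f else (mat z - A) $ k)"
      using ij by (auto simp: vec_eq_iff)
    finally show ?thesis by (simp add: poly_charpoly pq algebra_simps)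
  qed
  then have "smult (det P) (charpoly A) = [:- a, 1:] * [:- b, 1:] * q"
    by (intro poly_eq_poly_eq_iff[THEN iffD1] ext)
  ultimately show ?thesis by (rule that)
qed

text \<open>If the second entry exceeded \<open>max a b\<close>, only the head could be at most
  \<open>max a b\<close>, yet \<open>a\<close> and \<open>b\<close> both are. Positions count from
  0.\<close>

lemma sorted_list_second_le:
  fixes a b :: real
  assumes "M = {#a, b#} + R"
  shows "sorted_list_of_multiset M ! 1 \<le> max a b" and "sorted_list_of_multiset M ! 1 \<in># M"
proof -
  define l where "l = sorted_list_of_multiset M"
  have ml: "mset l = M" and sl: "sorted l" by (simp_all add: l_def)
  have "2 \<le> length l" using assms ml by (metis le_add1 size_mset size_union size_add_mset size_empty numeral_2_eq_2)
  then obtain p r t where l: "l = p # r # t" by (metis Suc_le_length_iff numeral_2_eq_2)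
  then show "sorted_list_of_multiset M ! 1 \<in># M" using ml by (auto simp flip: l_def)
  have "r \<le> max a b"
  proof (rule ccontr)
    assume r: "\<not> ?thesis"
    have "filter (\<lambda>s. s \<le> max a b) (r # t) = []"
      using sl l r by (auto simp: filter_empty_conv)
    then have "filter_mset (\<lambda>s. s \<le> max a b) (mset (r # t)) = {#}"
      by (metis mset_filter mset.simps(1))
    then have "size (filter_mset (\<lambda>s. s \<le> max a b) M) \<le> 1" using ml l by auto
    then show False using assms by simp
  qed
  then show "sorted_list_of_multiset M ! 1 \<le> max a b" using l by (simp flip: l_def)
qed

section \<open>Variational description of the second eigenvalue\<close>

lemma linear_coeff_zero:
  fixes b c :: real
  assumes "\<And>t. 0 \<le> 2 * t * b + t\<^sup>2 * c" shows "b = 0"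
proof (rule ccontr)
  assume b: "b \<noteq> 0"
  \<comment> \<open>With \<open>s\<close> above \<open>c\<close>, at \<open>t = - b / s\<close> the
    negative linear term outweighs the quadratic one.\<close>
  define s where "s = \<bar>c\<bar> + 1"
  have s: "0 < s" "c < s" by (auto simp: s_def)
  have "0 \<le> 2 * (- b / s) * b + (- b / s)\<^sup>2 * c" by (rule assms)
  also have "\<dots> = b\<^sup>2 * (c / s - 2) / s" using s by (simp add: field_simps power2_eq_square)
  also have "\<dots> < 0" using s b by (simp add: divide_neg_pos mult_pos_neg field_simps)
  finally show False by simp
qed

text \<open>The minimiser of the quadratic form on the unit sphere orthogonal to \<open>1\<close> is an
  eigenvector, so its eigenvalue and 0 are two entries of the list of eigenvalues.\<close>
lemma second_eigenvalue_one:
  fixes L :: "real^'n^'n" and e :: "real^'n"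
  assumes sym: "transpose L = L" and e: "e = (\<chi> i. 1)" and Le: "L *v e = 0" and psd: "\<And>f. 0 \<le> f \<bullet> (L *v f)"
    and card: "2 \<le> CARD('n)" and ev: "eigenvalue_list L ! 1 = 1"
  shows "e \<bullet> g = 0 \<Longrightarrow> g \<bullet> g \<le> g \<bullet> (L *v g)"
    and "\<exists>x. x \<noteq> 0 \<and> L *v x = x"
proof -
  have self: "v \<bullet> (L *v w) = w \<bullet> (L *v v)" for v w
    using dot_lmul_matrix[of v L w] sym by (metis inner_commute transpose_matrix_vector)
  let ?S = "{f :: real^'n. e \<bullet> f = 0} \<inter> sphere 0 1"
  obtain i j :: 'n where ij: "i \<noteq> j"
    using card by (metis card_2_iff' obtain_subset_with_card_n)
  have "e \<bullet> (axis i 1 - axis j 1) = 0" by (simp add: e inner_diff_right inner_axis)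
  moreover have "axis i (1::real) - axis j 1 \<noteq> 0" using ij by (auto simp: vec_eq_iff axis_def)
  ultimately have "(axis i 1 - axis j 1) /\<^sub>R norm (axis i (1::real) - axis j 1) \<in> ?S" by simp
  then have ne: "?S \<noteq> {}" by blast
  have cpt: "compact ?S" by (intro closed_Int_compact closed_hyperplane compact_sphere)
  have cont: "continuous_on ?S (\<lambda>f. f \<bullet> (L *v f))"
    by (intro continuous_intros matrix_vector_mult_linear_continuous_on)
  obtain f where f: "f \<in> ?S" and min: "\<And>g. g \<in> ?S \<Longrightarrow> f \<bullet> (L *v f) \<le> g \<bullet> (L *v g)"
    using continuous_attains_inf[OF cpt ne cont] by blast
  define m where "m = f \<bullet> (L *v f)"
  have ff: "f \<bullet> f = 1" "e \<bullet> f = 0" using f by (simp_all add: norm_eq_1)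
  have V: "m * (g \<bullet> g) \<le> g \<bullet> (L *v g)" if g: "e \<bullet> g = 0" for g
  proof (cases "g = 0")
    case False
    have "g /\<^sub>R norm g \<in> ?S" using g False by simp
    from min[OF this] have "m \<le> (g \<bullet> (L *v g)) / (norm g)\<^sup>2"
      by (simp add: m_def matrix_vector_mult_scaleR power2_eq_square divide_inverse mult_ac)
    with False show ?thesis by (simp add: field_simps power2_norm_eq_inner)
  qed simp
  \<comment> \<open>The residual \<open>w\<close> is an admissible direction, and the first-order
    condition along it at the minimiser reads \<open>w \<bullet> w = 0\<close>.\<close>
  define w where "w = L *v f - m *\<^sub>R f"
  have ew: "e \<bullet> w = 0" using self[of e f] Le ff by (simp add: w_def inner_diff_right)
  have "0 \<le> 2 * t * (w \<bullet> w) + t\<^sup>2 * (w \<bullet> (L *v w) - m * (w \<bullet> w))" for t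
  proof -
    have "e \<bullet> (f + t *\<^sub>R w) = 0" using ew ff by (simp add: inner_add_right)
    from V[OF this] have "0 \<le> (f + t *\<^sub>R w) \<bullet> (L *v (f + t *\<^sub>R w)) - m * ((f + t *\<^sub>R w) \<bullet> (f + t *\<^sub>R w))"
      by simp
    also have "\<dots> = 2 * t * (w \<bullet> (L *v f) - m * (w \<bullet> f)) + t\<^sup>2 * (w \<bullet> (L *v w) - m * (w \<bullet> w))"
      using self[of f w] ff
      by (simp add: matrix_vector_right_distrib matrix_vector_mult_scaleR inner_add_left inner_add_right
          m_def[symmetric] inner_commute[of f w] power2_eq_square algebra_simps)
    also have "w \<bullet> (L *v f) - m * (w \<bullet> f) = w \<bullet> w" by (simp add: w_def inner_diff_right)
    finally show ?thesis .
  qed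
  then have "w \<bullet> w = 0" by (rule linear_coeff_zero)
  then have Lf: "L *v f = m *\<^sub>R f" by (simp add: w_def)
  have "\<exists>i j. f $ i \<noteq> f $ j"
  proof (rule ccontr)
    assume "\<not> ?thesis"
    then have "f = f $ i *\<^sub>R e" by (simp add: e vec_eq_iff)
    then have "f \<bullet> f = f $ i * (e \<bullet> f)" by (metis inner_scaleR_left)
    with ff show False by simp
  qed
  then obtain i j where "e $ i * f $ j \<noteq> e $ j * f $ i" by (auto simp: e)
  moreover have "L *v e = 0 *\<^sub>R e" using Le by simp
  ultimately obtain c q where c: "c \<noteq> 0" "smult c (charpoly L) = [:- 0, 1:] * [:- m, 1:] * q"
    using charpoly_two_factors[OF sym _ Lf] by blast
  \<comment> \<open>The factors must be nonzero to split \<open>proots\<close>; nonnegativity of the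
    form excludes the root -1.\<close>
  have nz: "charpoly L \<noteq> 0"
  proof
    assume "charpoly L = 0"
    then have "poly (charpoly L) (- 1) = 0" by simp
    then obtain v where v: "v \<noteq> 0" "L *v v = - v" unfolding charpoly_root_iff by auto
    from psd[of v] v have "v \<bullet> v \<le> 0" by simp
    then show False using v(1) inner_gt_zero_iff[of v] by linarith
  qed
  then have "q \<noteq> 0" using c by auto
  have "proots ([:- 0, 1:] * [:- m, 1:] * q)
      = proots [:- 0, 1:] + proots [:- m, 1:] + proots q"
    using \<open>q \<noteq> 0\<close> by (subst proots_mult; (subst proots_mult)?) (auto simp del: mult_pCons_left)
  then have "proots (charpoly L) = {#m, 0#} + proots q"
    using proots_smult[OF c(1), of "charpoly L"] c(2)
    by (simp only: proots_linear_factor) simp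
  from sorted_list_second_le[OF this] have "1 \<le> max m 0" "1 \<in># proots (charpoly L)"
    using ev by (simp_all add: eigenvalue_list_def)
  then have "1 \<le> m" "poly (charpoly L) 1 = 0" using nz by auto
  then show "\<exists>x. x \<noteq> 0 \<and> L *v x = x" by (simp add: charpoly_root_iff)
  show "g \<bullet> g \<le> g \<bullet> (L *v g)" if "e \<bullet> g = 0"
    using V[OF that] mult_right_mono[OF \<open>1 \<le> m\<close>, of "g \<bullet> g"] by simp
qed

section \<open>Spectral gap, cut vertices and the Laplacian form\<close>

context adjacency
begin

lemma co_adjacency: "adjacency (co A)"
  by unfold_locales (auto simp: co_def adj_sym)

text \<open>Without an edge from \<open>D\<close> to the rest, the function constant on both parts and 0 at \<open>c\<close> attains
  equality in the gap only if \<open>c\<close> is dominating; but then \<open>c\<close> is isolated in the complement.\<close>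
lemma no_cut_vertex:
  assumes gap: "\<And>f :: 'v \<Rightarrow> real. (\<Sum>v\<in>UNIV. f v) = 0 \<Longrightarrow>
      2 * (\<Sum>v\<in>UNIV. (f v)\<^sup>2) \<le> (\<Sum>v\<in>UNIV. \<Sum>w\<in>nb A v. (f v - f w)\<^sup>2)"
    and co_gap: "\<And>f :: 'v \<Rightarrow> real. (\<Sum>v\<in>UNIV. f v) = 0 \<Longrightarrow>
      2 * (\<Sum>v\<in>UNIV. (f v)\<^sup>2) \<le> (\<Sum>v\<in>UNIV. \<Sum>w\<in>nb (co A) v. (f v - f w)\<^sup>2)"
    and D: "c \<notin> D" "D \<noteq> {}" "insert c D \<noteq> UNIV"
  shows "\<exists>s\<in>D. \<exists>t. t \<notin> insert c D \<and> A s t"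
proof (rule ccontr)
  assume "\<not> ?thesis"
  then have no: "\<not> A s t" "\<not> A t s" if "s \<in> D" "t \<notin> insert c D" for s t
    using that adj_sym by blast+
  define R where "R = - insert c D"
  \<comment> \<open>Each side carries the size of the other, with opposite signs, so that
    \<open>f\<close> sums to 0.\<close>
  define f :: "'v \<Rightarrow> real" where "f = (\<lambda>v. if v = c then 0 else if v \<in> D then real (card R) else - real (card D))"
  have R: "card R \<noteq> 0" using D(3) by (auto simp: R_def)
  have Dc: "card D \<noteq> 0" using D(2) by simp
  have fnz: "f v \<noteq> 0" if "v \<noteq> c" for v using that R Dc by (simp add: f_def)
  have "(\<Sum>v\<in>UNIV. f v) = (\<Sum>v\<in>insert c (D \<union> R). f v)" by (rule sum.cong) (auto simp: R_def)
  also have "\<dots> = f c + ((\<Sum>v\<in>D. f v) + (\<Sum>v\<in>R. f v))"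
    using D(1) by (subst sum.insert) (auto simp: R_def intro!: sum.union_disjoint)
  also have "(\<Sum>v\<in>D. f v) = (\<Sum>v\<in>D. real (card R))" using D(1) by (intro sum.cong) (auto simp: f_def)
  also have "(\<Sum>v\<in>R. f v) = (\<Sum>v\<in>R. - real (card D))" by (intro sum.cong) (auto simp: f_def R_def)
  also have "f c = 0" by (simp add: f_def)
  finally have sf: "(\<Sum>v\<in>UNIV. f v) = 0" by simp
  \<comment> \<open>Without edges between \<open>D\<close> and \<open>R\<close>, only edges at
    \<open>c\<close> contribute.\<close>
  have "(\<Sum>w\<in>nb A v. (f v - f w)\<^sup>2) = (\<Sum>w\<in>nb A v. if w = c then (f v)\<^sup>2 else 0)
      + (if v = c then \<Sum>w\<in>nb A c. (f w)\<^sup>2 else 0)" for v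
  proof (cases "v = c")
    case True
    then show ?thesis by (simp add: f_def power2_commute)
  next
    case False
    have "(f v - f w)\<^sup>2 = (if w = c then (f v)\<^sup>2 else 0)" if "A v w" for w
    proof (cases "w = c")
      case wc: False
      then have "v \<in> D \<longleftrightarrow> w \<in> D" using no[of v w] no[of w v] that False by auto
      then show ?thesis using False wc by (simp add: f_def)
    qed (simp add: f_def)
    then show ?thesis using False by (auto simp: nb_def intro!: sum.cong)
  qed
  then have "(\<Sum>v\<in>UNIV. \<Sum>w\<in>nb A v. (f v - f w)\<^sup>2)
      = (\<Sum>v\<in>UNIV. (if A v c then (f v)\<^sup>2 else 0)) + (\<Sum>w\<in>nb A c. (f w)\<^sup>2)"
    by (simp add: sum.distrib nb_def)
  also have "(\<Sum>v\<in>UNIV. (if A v c then (f v)\<^sup>2 else 0)) = (\<Sum>w\<in>nb A c. (f w)\<^sup>2)"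
    using adj_sym by (auto simp: nb_def sum.If_cases intro!: sum.cong)
  finally have "(\<Sum>v\<in>UNIV. (f v)\<^sup>2) \<le> (\<Sum>w\<in>nb A c. (f w)\<^sup>2)" using gap[OF sf] by simp
  moreover have "(\<Sum>v\<in>UNIV. (f v)\<^sup>2) = (\<Sum>w\<in>nb A c. (f w)\<^sup>2) + (\<Sum>w\<in>nb (co A) c. (f w)\<^sup>2)"
    by (subst sum_split[of _ c]) (simp add: f_def)
  ultimately have "(\<Sum>w\<in>nb (co A) c. (f w)\<^sup>2) = 0" by (simp add: sum_nonneg order_antisym)
  then have "nb (co A) c = {}" using fnz by (auto simp: sum_nonneg_eq_0_iff nb_co)
  then have iso: "\<not> co A c w" "\<not> co A w c" for w by (auto simp: nb_def co_def adj_sym)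
  \<comment> \<open>Constant away from the isolated vertex \<open>c\<close>, the nonzero function
    \<open>h\<close> has no difference along any edge of the complement.\<close>
  define h :: "'v \<Rightarrow> real" where "h = (\<lambda>v. (if v = c then real CARD('v) else 0) - 1)"
  have "(\<Sum>v\<in>UNIV. h v) = 0" by (simp add: h_def sum_subtractf)
  from co_gap[OF this] have "2 * (\<Sum>v\<in>UNIV. (h v)\<^sup>2) \<le> (\<Sum>v\<in>UNIV. \<Sum>w\<in>nb (co A) v. (h v - h w)\<^sup>2)" .
  also have "\<dots> = 0"
  proof (intro sum.neutral ballI)
    fix v w assume "w \<in> nb (co A) v"
    then have "v \<noteq> c" "w \<noteq> c" using iso by (auto simp: nb_def)
    then show "(h v - h w)\<^sup>2 = 0" by (simp add: h_def)
  qed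
  finally have "(\<Sum>v\<in>UNIV. (h v)\<^sup>2) = 0" by (simp add: sum_nonneg order_antisym)
  then have "h v = 0" for v by (simp add: sum_nonneg_eq_0_iff)
  moreover obtain v where "v \<in> D" using D(2) by auto
  ultimately have "h v = 0" "v \<noteq> c" using D(1) by auto
  then show False by (simp add: h_def)
qed

text \<open>Expand the squares and double count; each edge occurs in both orientations, whence the
  factor 2.\<close>

lemma laplacian_form:
  assumes L: "\<And>f v. (L *v f) $ v = real (deg A v) * f $ v - (\<Sum>w\<in>nb A v. f $ w)"
  shows "2 * (f \<bullet> (L *v f)) = (\<Sum>v\<in>UNIV. \<Sum>w\<in>nb A v. (f $ v - f $ w)\<^sup>2)"
proof -
  have "(\<Sum>v\<in>UNIV. \<Sum>w\<in>nb A v. (f $ v - f $ w)\<^sup>2)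
      = (\<Sum>v\<in>UNIV. real (deg A v) * (f $ v)\<^sup>2) + (\<Sum>v\<in>UNIV. 1 * (\<Sum>w\<in>nb A v. (f $ w)\<^sup>2))
        - 2 * (\<Sum>v\<in>UNIV. f $ v * (\<Sum>w\<in>nb A v. f $ w))"
    by (simp add: power2_diff sum.distrib sum_subtractf deg_def mult.assoc flip: sum_distrib_left)
  also have "(\<Sum>v\<in>UNIV. 1 * (\<Sum>w\<in>nb A v. (f $ w)\<^sup>2)) = (\<Sum>v\<in>UNIV. real (deg A v) * (f $ v)\<^sup>2)"
    by (subst double_count) (simp add: deg_def mult.commute)
  also have "(\<Sum>v\<in>UNIV. real (deg A v) * (f $ v)\<^sup>2) + (\<Sum>v\<in>UNIV. real (deg A v) * (f $ v)\<^sup>2)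
      - 2 * (\<Sum>v\<in>UNIV. f $ v * (\<Sum>w\<in>nb A v. f $ w)) = 2 * (f \<bullet> (L *v f))"
    by (simp add: inner_vec_def L right_diff_distrib sum_subtractf power2_eq_square mult.left_commute)
  finally show ?thesis by simp
qed

end

section \<open>Passage from edge sets to adjacency relations\<close>

lemma adjacency_edges:
  assumes "simple_graph E" shows "adjacency (\<lambda>v w. {v, w} \<in> E)"
  using assms by unfold_locales (auto simp: insert_commute simple_graph_def)

lemma co_edges: "co (\<lambda>v w. {v, w} \<in> E) = (\<lambda>v w. {v, w} \<in> graph_complement E)"
  by (auto simp: fun_eq_iff co_def graph_complement_def card_insert_if)

lemma laplacian_mult:
  assumes "simple_graph E"
  shows "(laplacian E *v f) $ v = real (deg (\<lambda>v w. {v, w} \<in> E) v) * f $ v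
      - (\<Sum>w\<in>nb (\<lambda>v w. {v, w} \<in> E) v. f $ w)"
proof -
  interpret adjacency "\<lambda>v w. {v, w} \<in> E" by (rule adjacency_edges[OF assms])
  let ?N = "nb (\<lambda>v w. {v, w} \<in> E) v"
  have "{e \<in> E. v \<in> e} = (\<lambda>w. {v, w}) ` ?N"
  proof (intro equalityI subsetI)
    fix e assume e: "e \<in> {e \<in> E. v \<in> e}"
    then have "card e = 2" using assms by (auto simp: simple_graph_def)
    with e obtain w where "e = {v, w}" by (auto simp: card_2_iff)
    with e show "e \<in> (\<lambda>w. {v, w}) ` ?N" by (auto simp: nb_def)
  qed (auto simp: nb_def)
  moreover have "inj_on (\<lambda>w. {v, w}) ?N" by (auto simp: inj_on_def doubleton_eq_iff)
  ultimately have d: "vertex_degree E v = deg (\<lambda>v w. {v, w} \<in> E) v"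
    by (simp add: vertex_degree_def deg_def card_image)
  have "laplacian E $ v $ w * f $ w = (if w = v then real (vertex_degree E v) * f $ w else 0)
      - (if {v, w} \<in> E then f $ w else 0)" for w
    using adj_irrefl[of v] by (simp add: laplacian_def)
  then show ?thesis
    by (simp add: matrix_vector_mult_def sum_subtractf d nb_def sum.If_cases)
qed

text \<open>Used for the graph and for its complement: the gap inequality feeds
  \<open>no_cut_vertex\<close>, and the eigenfunction feeds
  \<open>no_eigenfunction_pair\<close>.\<close>

lemma eigensimple_side:
  fixes E :: "'v::finite set set" and f :: "'v \<Rightarrow> real"
  assumes E: "simple_graph E" and card: "2 \<le> CARD('v)" and ev: "laplacian_eigenvalue 2 E = 1"
  defines "A \<equiv> \<lambda>v w. {v, w} \<in> E"
  shows "(\<Sum>v\<in>UNIV. f v) = 0 \<Longrightarrow>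
      2 * (\<Sum>v\<in>UNIV. (f v)\<^sup>2) \<le> (\<Sum>v\<in>UNIV. \<Sum>w\<in>nb A v. (f v - f w)\<^sup>2)"
    and "\<exists>x. eigf A x"
proof -
  interpret adjacency A unfolding A_def by (rule adjacency_edges[OF E])
  define L where "L = laplacian E"
  define e :: "real^'v" where "e = (\<chi> v. 1)"
  have L: "(L *v f) $ v = real (deg A v) * f $ v - (\<Sum>w\<in>nb A v. f $ w)" for f v
    unfolding L_def A_def by (rule laplacian_mult[OF E])
  have form: "2 * (f \<bullet> (L *v f)) = (\<Sum>v\<in>UNIV. \<Sum>w\<in>nb A v. (f $ v - f $ w)\<^sup>2)" for f
    by (rule laplacian_form[OF L])
  have ee: "e \<bullet> f = (\<Sum>v\<in>UNIV. f $ v)" for f by (simp add: e_def inner_vec_def)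
  have sym: "transpose L = L"
    by (auto simp: L_def laplacian_def transpose_def vec_eq_iff insert_commute)
  have Le: "L *v e = 0" by (simp add: vec_eq_iff L) (simp add: e_def deg_def)
  have psd: "0 \<le> f \<bullet> (L *v f)" for f
    using form[of f] by (smt (verit) sum_nonneg zero_le_power2)
  have "eigenvalue_list L ! 1 = 1" using ev by (simp add: laplacian_eigenvalue_def L_def)
  note two = second_eigenvalue_one[OF sym e_def Le psd card this]
  show "2 * (\<Sum>v\<in>UNIV. (f v)\<^sup>2) \<le> (\<Sum>v\<in>UNIV. \<Sum>w\<in>nb A v. (f v - f w)\<^sup>2)"
    if "(\<Sum>v\<in>UNIV. f v) = 0"
  proof -
    have "e \<bullet> (\<chi> v. f v) = 0" using that by (simp add: ee)
    from two(1)[OF this] form[of "\<chi> v. f v"] show ?thesis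
      by (simp add: inner_vec_def power2_eq_square)
  qed
  obtain x where x: "x \<noteq> 0" "L *v x = x" using two(2) by auto
  \<comment> \<open>Since \<open>L\<close> is symmetric and kills \<open>e\<close>, the eigenvector
    is orthogonal to the constants.\<close>
  have "e \<bullet> x = e \<bullet> (L *v x)" by (simp add: x)
  also have "\<dots> = (transpose L *v e) \<bullet> x"
    by (metis dot_lmul_matrix transpose_matrix_vector)
  finally have sx: "(\<Sum>v\<in>UNIV. x $ v) = 0" by (simp add: sym Le ee)
  define r where "r = (\<Sum>v\<in>UNIV. \<bar>x $ v\<bar>)"
  have "r \<noteq> 0" using x(1) by (auto simp: r_def sum_nonneg_eq_0_iff vec_eq_iff)
  moreover have "0 \<le> r" by (simp add: r_def sum_nonneg)
  ultimately have r: "0 < r" by simp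
  have "(\<Sum>w\<in>nb A v. x $ w) = (real (deg A v) - 1) * x $ v" for v
    using L[of x v] x(2) by (simp add: algebra_simps)
  then have "eigf A (\<lambda>v. 2 / r * x $ v)"
    using r sx unfolding eigf_def sum_distrib_left[symmetric] abs_mult
    by (simp add: r_def[symmetric])
  then show "\<exists>x. eigf A x" by blast
qed

theorem theorem4p2:
  assumes "CARD('v::finite) \<ge> 32"
  shows "\<not> (\<exists>E :: 'v set set. eigensimple E)"
proof
  assume "\<exists>E :: 'v set set. eigensimple E"
  then obtain E :: "'v set set" where E: "eigensimple E" ..
  define A where "A = (\<lambda>v w. {v, w} \<in> E)"
  have coA: "co A = (\<lambda>v w. {v, w} \<in> graph_complement E)" unfolding A_def by (rule co_edges)
  have sg: "simple_graph E" "simple_graph (graph_complement E)"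
    using E by (auto simp: eigensimple_def simple_graph_def graph_complement_def)
  have ev: "laplacian_eigenvalue 2 E = 1" "laplacian_eigenvalue 2 (graph_complement E) = 1"
    using E by (auto simp: eigensimple_def)
  have card: "2 \<le> CARD('v)" using assms by simp
  note s1 = eigensimple_side[OF sg(1) card ev(1), folded A_def]
  note s2 = eigensimple_side[OF sg(2) card ev(2), folded coA]
  interpret adjacency A unfolding A_def by (rule adjacency_edges[OF sg(1)])
  interpret H: adjacency "co A" by (rule co_adjacency)
  have cc: "co (co A) = A" by (auto simp: fun_eq_iff co_def adj_irrefl)
  interpret tough_pair A
  proof
    show "\<exists>s\<in>D. \<exists>t. t \<notin> insert c D \<and> A s t" if "c \<notin> D" "D \<noteq> {}" "insert c D \<noteq> UNIV" for c D
      by (rule no_cut_vertex[OF s1(1) s2(1) that])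
    show "\<exists>s\<in>D. \<exists>t. t \<notin> insert c D \<and> co A s t" if "c \<notin> D" "D \<noteq> {}" "insert c D \<noteq> UNIV" for c D
      by (rule H.no_cut_vertex[unfolded cc, OF s2(1) s1(1) that])
  qed (rule assms)+
  show False using s1(2) s2(2) no_eigenfunction_pair by blast
qed

end
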